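(* Let $(R,\mu)$ be a $\sigma$-finite nonatomic measure space with $\mu(R)=\infty$, and let $X$ and $Y$ be quasi-Banach function spaces over $(R,\mu)$. The following two statements are equivalent. (i) $X\overset{*}{\underset{loc}{\hookrightarrow}}Y$. (ii) For every bounded sequence $\{f_n\}_{n=1}^\infty\subseteq X$ in $X$ such that $\lim_{n\to\infty}\mu(\operatorname{supp}f_n)=0$, we have $\lim_{n\to\infty}\|f_n\|_Y=0$.
   Context: All sets $E\subseteq R$ are understood to be $\mu$-measurable; $\operatorname{supp}f=\{x\in R:f(x)\ne0\}$. $\mathscr M(R,\mu)$ is the set of $\mu$-measurable functions on $R$, and $\mathscr M^+(R,\mu)$ its subset of functions nonnegative $\mu$-a.e. A functional $\|\cdot\|_X\colon\mathscr M^+(R,\mu)\to[0,\infty]$ is a quasi-Banach function norm if for all $f,g,f_j\in\mathscr M^+(R,\mu)$: (P1) $\|f\|_X=0$ iff $f=0$ a.e., $\|\lambda f\|_X=\lambda\|f\|_X$ for $\lambda\ge0$, and there is a constant $C_X\in[1,\infty)$ with $\|f+g\|_X\le C_X(\|f\|_X+\|g\|_X)$; (P2) $f\le g$ a.e. implies $\|f\|_X\le\|g\|_X$; (P3) $f_j\nearrow f$ a.e. implies $\|f_j\|_X\nearrow\|f\|_X$; (P4) $\|\chi_E\|_X<\infty$ whenever $\mu(E)<\infty$. It is extended to $\mathscr M(R,\mu)$ by $\|f\|_X=\|\,|f|\,\|_X$, and $X=\{f\in\mathscr M(R,\mu):\|f\|_X<\infty\}$ is called a quasi-Banach function space (q-BFS).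 For q-BFSs $X,Y$, write $X\overset{*}{\underset{loc}{\hookrightarrow}}Y$ if $\lim_{a\to0_+}\sup_{\|f\|_X\le1}\sup_{\mu(E)\le a}\|f\chi_E\|_Y=0$. *)

theory Defs
  imports "HOL-Analysis.Analysis"
begin

definition nonatomic :: "'a measure \<Rightarrow> bool" where
  "nonatomic M \<longleftrightarrow>
     (\<forall>E\<in>sets M. emeasure M E > 0 \<longrightarrow>
        (\<exists>F\<in>sets M. F \<subseteq> E \<and> 0 < emeasure M F \<and> emeasure M F < emeasure M E))"

text \<open>
  Measurable functions take values in the extended reals, so that the pointwise a.e. limit of an
  increasing sequence of functions is again a measurable function. Functions are not identified
  when they agree almost everywhere.
\<close>

definition nonneg_measurable :: "'a measure \<Rightarrow> ('a \<Rightarrow> ereal) set" where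
  "nonneg_measurable M = {f \<in> borel_measurable M. AE x in M. 0 \<le> f x}"

text \<open>
  The functional is only meaningful on \<^const>\<open>nonneg_measurable\<close>; its values elsewhere are
  unconstrained. In the homogeneity axiom and in products with indicators, \<open>0 * \<infinity> = 0\<close>.
\<close>

definition quasi_banach_function_norm :: "'a measure \<Rightarrow> (('a \<Rightarrow> ereal) \<Rightarrow> ennreal) \<Rightarrow> bool" where
  "quasi_banach_function_norm M \<rho> \<longleftrightarrow>
     (\<forall>f\<in>nonneg_measurable M. \<rho> f = 0 \<longleftrightarrow> (AE x in M. f x = 0)) \<and>
     (\<forall>f\<in>nonneg_measurable M. \<forall>c\<ge>0. \<rho> (\<lambda>x. ereal c * f x) = ennreal c * \<rho> f) \<and>
     (\<exists>C\<ge>1. \<forall>f\<in>nonneg_measurable M. \<forall>g\<in>nonneg_measurable M.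
        \<rho> (\<lambda>x. f x + g x) \<le> ennreal C * (\<rho> f + \<rho> g)) \<and>
     (\<forall>f\<in>nonneg_measurable M. \<forall>g\<in>nonneg_measurable M.
        (AE x in M. f x \<le> g x) \<longrightarrow> \<rho> f \<le> \<rho> g) \<and>
     (\<forall>F f. (\<forall>j::nat. F j \<in> nonneg_measurable M) \<and> f \<in> nonneg_measurable M \<and>
        (AE x in M. incseq (\<lambda>j. F j x) \<and> (\<lambda>j. F j x) \<longlonglongrightarrow> f x) \<longrightarrow>
        incseq (\<lambda>j. \<rho> (F j)) \<and> (\<lambda>j. \<rho> (F j)) \<longlonglongrightarrow> \<rho> f) \<and>
     (\<forall>E\<in>sets M. emeasure M E < \<infinity> \<longrightarrow> \<rho> (indicator E) < \<infinity>)"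

definition qnorm :: "(('a \<Rightarrow> ereal) \<Rightarrow> ennreal) \<Rightarrow> ('a \<Rightarrow> ereal) \<Rightarrow> ennreal" where
  "qnorm \<rho> f = \<rho> (\<lambda>x. \<bar>f x\<bar>)"

definition qbfs :: "'a measure \<Rightarrow> (('a \<Rightarrow> ereal) \<Rightarrow> ennreal) \<Rightarrow> ('a \<Rightarrow> ereal) set" where
  "qbfs M \<rho> = {f \<in> borel_measurable M. qnorm \<rho> f < \<infinity>}"

definition supp :: "'a measure \<Rightarrow> ('a \<Rightarrow> ereal) \<Rightarrow> 'a set" where
  "supp M f = {x \<in> space M. f x \<noteq> 0}"

definition loc_almost_compact_emb ::
  "'a measure \<Rightarrow> (('a \<Rightarrow> ereal) \<Rightarrow> ennreal) \<Rightarrow> (('a \<Rightarrow> ereal) \<Rightarrow> ennreal) \<Rightarrow> bool" where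
  "loc_almost_compact_emb M \<rho>X \<rho>Y \<longleftrightarrow>
     ((\<lambda>a::real. SUP f\<in>{f \<in> qbfs M \<rho>X. qnorm \<rho>X f \<le> 1}.
                  SUP E\<in>{E \<in> sets M. emeasure M E \<le> ennreal a}.
                    qnorm \<rho>Y (\<lambda>x. f x * indicator E x)) \<longlongrightarrow> 0) (at_right 0)"

end

theory Submission
  imports Defs
begin

text \<open>
  Both statements say that the quasi-norm in \<open>Y\<close> of functions from a ball of \<open>X\<close> is small,
  uniformly over the ball, once their supports are small. A bounded sequence is rescaled into the
  unit ball and multiplied by the indicators of its supports; conversely, if the suprema do not tend
  to zero, almost maximal pairs \<open>(f\<^sub>n, E\<^sub>n)\<close> with \<open>\<mu>(E\<^sub>n) \<le> 1/(n+1)\<close> give a sequence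
  \<open>f\<^sub>n \<chi>\<^bsub>E\<^sub>n\<^esub>\<close> that violates the sequential condition.
\<close>

text \<open>Nothing in \<open>ennreal\<close> lies below 0, so only upper bounds remain of the order
  characterisation of limits.\<close>

lemma tendsto_0_ennreal_iff:
  fixes g :: "'b \<Rightarrow> ennreal"
  shows "(g \<longlongrightarrow> 0) F \<longleftrightarrow> (\<forall>e>0. eventually (\<lambda>x. g x < e) F)"
  by (simp add: order_tendsto_iff)

lemma abs_in_nonneg_measurable:
  assumes "f \<in> borel_measurable M"
  shows "(\<lambda>x. \<bar>f x\<bar>) \<in> nonneg_measurable M"
  using assms by (auto simp: nonneg_measurable_def)

lemma qnorm_mono:
  assumes "quasi_banach_function_norm M \<rho>"
    and "f \<in> borel_measurable M" "g \<in> borel_measurable M"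
    and "\<And>x. x \<in> space M \<Longrightarrow> \<bar>f x\<bar> \<le> \<bar>g x\<bar>"
  shows "qnorm \<rho> f \<le> qnorm \<rho> g"
proof -
  have "AE x in M. \<bar>f x\<bar> \<le> \<bar>g x\<bar>" using assms(4) by (rule AE_I2)
  moreover have "\<forall>f\<in>nonneg_measurable M. \<forall>g\<in>nonneg_measurable M.
      (AE x in M. f x \<le> g x) \<longrightarrow> \<rho> f \<le> \<rho> g"
    using assms(1) unfolding quasi_banach_function_norm_def by (elim conjE)
  ultimately show ?thesis
    using abs_in_nonneg_measurable[OF assms(2)] abs_in_nonneg_measurable[OF assms(3)]
    unfolding qnorm_def by simp
qed

lemma qnorm_scale:
  assumes "quasi_banach_function_norm M \<rho>"
    and "f \<in> borel_measurable M" and "c \<ge> 0"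
  shows "qnorm \<rho> (\<lambda>x. ereal c * f x) = ennreal c * qnorm \<rho> f"
proof -
  have "(\<lambda>x. \<bar>ereal c * f x\<bar>) = (\<lambda>x. ereal c * \<bar>f x\<bar>)"
  proof
    fix x
    \<comment> \<open>Infinite values of \<open>f\<close> are covered too: if \<open>c\<close> is 0,
      both sides vanish there because 0 times infinity is 0.\<close>
    show "\<bar>ereal c * f x\<bar> = ereal c * \<bar>f x\<bar>"
      using assms(3) by (cases "f x") (auto simp: abs_mult)
  qed
  then show ?thesis
    using assms(1,3) abs_in_nonneg_measurable[OF assms(2)]
    unfolding qnorm_def quasi_banach_function_norm_def by simp
qed

lemma supp_in_sets:
  assumes "f \<in> borel_measurable M"
  shows "supp M f \<in> sets M"
  using assms unfolding supp_def by measurable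

text \<open>After rescaling into the unit ball, cutting a function off to its own support changes
  nothing, so the supremum over all sets of small measure bounds its norm in
  \<open>Y\<close>.\<close>

lemma loc_almost_compact_emb_imp_seq:
  assumes X: "quasi_banach_function_norm M \<rho>X" and Y: "quasi_banach_function_norm M \<rho>Y"
    and emb: "loc_almost_compact_emb M \<rho>X \<rho>Y"
    and f: "\<And>n. f n \<in> qbfs M \<rho>X" and B: "\<And>n. qnorm \<rho>X (f n) \<le> ennreal B"
    and supp: "(\<lambda>n. emeasure M (supp M (f n))) \<longlonglongrightarrow> 0"
  shows "(\<lambda>n::nat. qnorm \<rho>Y (f n)) \<longlonglongrightarrow> 0"
  unfolding tendsto_0_ennreal_iff
proof (intro allI impI)
  fix e :: ennreal assume "e > 0"
  \<comment> \<open>\<open>B\<close> may be zero or negative; the rescaling needs a positive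
    bound.\<close>
  define b where "b = max B 1"
  define g where "g n = (\<lambda>x. ereal (1 / b) * f n x)" for n
  define \<Phi> where "\<Phi> a = (SUP f\<in>{f \<in> qbfs M \<rho>X. qnorm \<rho>X f \<le> 1}.
      SUP E\<in>{E \<in> sets M. emeasure M E \<le> ennreal a}. qnorm \<rho>Y (\<lambda>x. f x * indicator E x))" for a
  have b: "b > 0" "B \<le> b" by (auto simp: b_def)
  have fm [measurable]: "f n \<in> borel_measurable M" for n using f[of n] by (simp add: qbfs_def)
  have gm [measurable]: "g n \<in> borel_measurable M" for n unfolding g_def by measurable
  have gX: "qnorm \<rho>X (g n) \<le> 1" for n
  proof -
    have "qnorm \<rho>X (g n) = ennreal (1 / b) * qnorm \<rho>X (f n)"
      unfolding g_def using b by (intro qnorm_scale[OF X]) auto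
    also have "\<dots> \<le> ennreal (1 / b) * ennreal b"
      using B[of n] b by (intro mult_left_mono) (auto intro: order_trans ennreal_leI)
    also have "\<dots> = 1" using b by (simp flip: ennreal_mult)
    finally show ?thesis .
  qed
  have gball: "g n \<in> {f \<in> qbfs M \<rho>X. qnorm \<rho>X f \<le> 1}" for n
    using gX[of n] by (auto simp: qbfs_def intro: le_less_trans)
  have fg: "qnorm \<rho>Y (f n) = ennreal b * qnorm \<rho>Y (g n)" for n
  proof -
    have "ennreal b * qnorm \<rho>Y (g n) = ennreal b * (ennreal (1 / b) * qnorm \<rho>Y (f n))"
      unfolding g_def using b by (subst qnorm_scale[OF Y]) auto
    also have "\<dots> = qnorm \<rho>Y (f n)"
      using b by (simp flip: mult.assoc ennreal_mult)
    finally show ?thesis ..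
  qed
  \<comment> \<open>The factor \<open>b\<close> is kept inside the limit, so that \<open>e\<close>,
    which may be infinite, is never divided.\<close>
  have "ennreal b * 0 < e" using \<open>e > 0\<close> by simp
  moreover have "((\<lambda>a. ennreal b * \<Phi> a) \<longlongrightarrow> ennreal b * 0) (at_right 0)"
    using emb unfolding loc_almost_compact_emb_def \<Phi>_def[symmetric]
    by (intro ennreal_tendsto_cmult) auto
  ultimately have "eventually (\<lambda>a. ennreal b * \<Phi> a < e) (at_right 0)"
    by (simp add: tendsto_0_ennreal_iff)
  then obtain a where a: "a > 0" "ennreal b * \<Phi> a < e"
    unfolding eventually_at_right_field by (metis dense)
  have "eventually (\<lambda>n. emeasure M (supp M (f n)) < ennreal a) sequentially"
    using supp a(1) by (simp add: tendsto_0_ennreal_iff)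
  then show "eventually (\<lambda>n. qnorm \<rho>Y (f n) < e) sequentially"
  proof eventually_elim
    case (elim n)
    have [measurable]: "supp M (f n) \<in> sets M" by (intro supp_in_sets fm)
    \<comment> \<open>Both functions agree on the space, since \<open>g n\<close> vanishes wherever
      \<open>f n\<close> does.\<close>
    have "qnorm \<rho>Y (g n) \<le> qnorm \<rho>Y (\<lambda>x. g n x * indicator (supp M (f n)) x)"
      by (intro qnorm_mono[OF Y]) (auto simp: supp_def g_def indicator_def)
    also have "\<dots> \<le> \<Phi> a"
      unfolding \<Phi>_def using elim
      by (intro SUP_upper2[OF gball[of n]] SUP_upper) auto
    finally have "qnorm \<rho>Y (f n) \<le> ennreal b * \<Phi> a"
      unfolding fg by (rule mult_left_mono) simp
    then show ?case using a(2) by (rule le_less_trans)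
  qed
qed

text \<open>The bound 1 suffices in the sequential hypothesis: the pairs come from the unit ball,
  and multiplying by an indicator does not increase the norm in \<open>X\<close>.\<close>

lemma seq_imp_loc_almost_compact_emb:
  assumes X: "quasi_banach_function_norm M \<rho>X"
    and seq: "\<And>f :: nat \<Rightarrow> 'a \<Rightarrow> ereal. (\<And>n. f n \<in> qbfs M \<rho>X) \<Longrightarrow>
      (\<And>n. qnorm \<rho>X (f n) \<le> 1) \<Longrightarrow> (\<lambda>n. emeasure M (supp M (f n))) \<longlonglongrightarrow> 0 \<Longrightarrow>
      (\<lambda>n. qnorm \<rho>Y (f n)) \<longlonglongrightarrow> 0"
  shows "loc_almost_compact_emb M \<rho>X \<rho>Y"
proof (rule ccontr)
  assume neg: "\<not> loc_almost_compact_emb M \<rho>X \<rho>Y"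
  define \<Phi> where "\<Phi> a = (SUP f\<in>{f \<in> qbfs M \<rho>X. qnorm \<rho>X f \<le> 1}.
      SUP E\<in>{E \<in> sets M. emeasure M E \<le> ennreal a}. qnorm \<rho>Y (\<lambda>x. f x * indicator E x))" for a
  \<comment> \<open>A larger \<open>a\<close> admits more sets \<open>E\<close>. Hence one small
    value of \<open>\<Phi>\<close> would force small values on a whole right neighbourhood of
    0.\<close>
  have mono: "\<Phi> a \<le> \<Phi> a'" if "a \<le> a'" for a a'
    unfolding \<Phi>_def using that
    by (intro SUP_mono' SUP_subset_mono) (auto intro: order_trans ennreal_leI)
  from neg obtain e where e: "e > 0" "\<not> eventually (\<lambda>a. \<Phi> a < e) (at_right 0)"
    unfolding loc_almost_compact_emb_def \<Phi>_def[symmetric] tendsto_0_ennreal_iff by blast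
  \<comment> \<open>The supremum need not be attained; a strict lower bound \<open>d\<close> for
    \<open>\<Phi>\<close> is what yields actual witnesses \<open>f\<close> and
    \<open>E\<close>.\<close>
  obtain d where d: "0 < d" "d < e" using dense[OF e(1)] by blast
  have large: "d < \<Phi> a" if "a > 0" for a
  proof (rule ccontr)
    assume "\<not> d < \<Phi> a"
    then have "\<Phi> a < e" using d(2) by simp
    then have "\<forall>y>0. y < a \<longrightarrow> \<Phi> y < e" using mono by (meson le_less_trans less_imp_le)
    then have "eventually (\<lambda>a. \<Phi> a < e) (at_right 0)"
      unfolding eventually_at_right_field using that by blast
    with e(2) show False by blast
  qed
  \<comment> \<open>A number lies strictly below a supremum iff it lies strictly below some member;
    used twice, this unfolds the nested suprema. \<open>Suc n\<close> keeps the radius positive at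
    \<open>n = 0\<close>.\<close>
  have "\<exists>f E. f \<in> qbfs M \<rho>X \<and> qnorm \<rho>X f \<le> 1 \<and> E \<in> sets M \<and>
      emeasure M E \<le> ennreal (1 / real (Suc n)) \<and> d < qnorm \<rho>Y (\<lambda>x. f x * indicator E x)" for n
    using large[of "1 / real (Suc n)"] unfolding \<Phi>_def less_SUP_iff by auto
  then obtain f E where f: "\<And>n. f n \<in> qbfs M \<rho>X" "\<And>n. qnorm \<rho>X (f n) \<le> 1"
    and E: "\<And>n. E n \<in> sets M" "\<And>n. emeasure M (E n) \<le> ennreal (1 / real (Suc n))"
    and large_f: "\<And>n. d < qnorm \<rho>Y (\<lambda>x. f n x * indicator (E n) x)"
    by metis
  define h where "h n = (\<lambda>x. f n x * indicator (E n) x)" for n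
  have fm [measurable]: "f n \<in> borel_measurable M" for n using f(1)[of n] by (simp add: qbfs_def)
  have [measurable]: "E n \<in> sets M" for n by (rule E)
  have hm [measurable]: "h n \<in> borel_measurable M" for n unfolding h_def by measurable
  have hX: "qnorm \<rho>X (h n) \<le> 1" for n
  proof -
    have "qnorm \<rho>X (h n) \<le> qnorm \<rho>X (f n)"
      by (intro qnorm_mono[OF X]) (auto simp: h_def indicator_def)
    with f(2)[of n] show ?thesis by simp
  qed
  have h: "h n \<in> qbfs M \<rho>X" for n
    using hX[of n] by (auto simp: qbfs_def intro: le_less_trans)
  have "(\<lambda>n. ennreal (1 / real (Suc n))) \<longlonglongrightarrow> ennreal 0"
    using LIMSEQ_inverse_real_of_nat by (intro tendsto_ennrealI) (simp add: inverse_eq_divide)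
  then have lim: "(\<lambda>n. ennreal (1 / real (Suc n))) \<longlonglongrightarrow> 0" by simp
  have "emeasure M (supp M (h n)) \<le> ennreal (1 / real (Suc n))" for n
  proof -
    have "emeasure M (supp M (h n)) \<le> emeasure M (E n)"
      \<comment> \<open>The product with the indicator vanishes off \<open>E n\<close>, so its
        support lies in \<open>E n\<close>.\<close>
      by (intro emeasure_mono) (auto simp: supp_def h_def indicator_def split: if_splits)
    with E(2)[of n] show ?thesis by (rule order_trans[rotated])
  qed
  then have "(\<lambda>n. emeasure M (supp M (h n))) \<longlonglongrightarrow> 0"
    by (intro tendsto_sandwich[OF _ _ tendsto_const lim]) auto
  then have "(\<lambda>n. qnorm \<rho>Y (h n)) \<longlonglongrightarrow> 0" by (intro seq h hX)
  then have "eventually (\<lambda>n. qnorm \<rho>Y (h n) < d) sequentially"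
    using d(1) by (simp add: tendsto_0_ennreal_iff)
  \<comment> \<open>A single index is enough, as every term of the sequence has norm above
    \<open>d\<close>.\<close>
  then obtain n where "qnorm \<rho>Y (h n) < d" by (auto simp: eventually_sequentially)
  with large_f[of n] show False by (simp add: h_def)
qed

theorem theorem4p6:
  fixes M :: "'a measure" and \<rho>X \<rho>Y :: "('a \<Rightarrow> ereal) \<Rightarrow> ennreal"
  assumes "sigma_finite_measure M"
    and "nonatomic M"
    and "emeasure M (space M) = \<infinity>"
    and "quasi_banach_function_norm M \<rho>X"
    and "quasi_banach_function_norm M \<rho>Y"
  shows "loc_almost_compact_emb M \<rho>X \<rho>Y \<longleftrightarrow>
    (\<forall>f :: nat \<Rightarrow> 'a \<Rightarrow> ereal.
       (\<forall>n. f n \<in> qbfs M \<rho>X) \<longrightarrow>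
       (\<exists>B::real. \<forall>n. qnorm \<rho>X (f n) \<le> ennreal B) \<longrightarrow>
       (\<lambda>n. emeasure M (supp M (f n))) \<longlonglongrightarrow> 0 \<longrightarrow>
       (\<lambda>n. qnorm \<rho>Y (f n)) \<longlonglongrightarrow> 0)"
proof (intro iffI allI impI)
  fix f :: "nat \<Rightarrow> 'a \<Rightarrow> ereal"
  assume "loc_almost_compact_emb M \<rho>X \<rho>Y" "\<forall>n. f n \<in> qbfs M \<rho>X"
    "\<exists>B::real. \<forall>n. qnorm \<rho>X (f n) \<le> ennreal B"
    "(\<lambda>n. emeasure M (supp M (f n))) \<longlonglongrightarrow> 0"
  then show "(\<lambda>n. qnorm \<rho>Y (f n)) \<longlonglongrightarrow> 0"
    using loc_almost_compact_emb_imp_seq[OF assms(4,5)] by blast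
next
  assume seq: "\<forall>f :: nat \<Rightarrow> 'a \<Rightarrow> ereal. (\<forall>n. f n \<in> qbfs M \<rho>X) \<longrightarrow>
    (\<exists>B::real. \<forall>n. qnorm \<rho>X (f n) \<le> ennreal B) \<longrightarrow>
    (\<lambda>n. emeasure M (supp M (f n))) \<longlonglongrightarrow> 0 \<longrightarrow> (\<lambda>n. qnorm \<rho>Y (f n)) \<longlonglongrightarrow> 0"
  show "loc_almost_compact_emb M \<rho>X \<rho>Y"
  proof (rule seq_imp_loc_almost_compact_emb[OF assms(4)])
    fix f :: "nat \<Rightarrow> 'a \<Rightarrow> ereal"
    assume "\<And>n. f n \<in> qbfs M \<rho>X" and le: "\<And>n. qnorm \<rho>X (f n) \<le> 1"
      and "(\<lambda>n. emeasure M (supp M (f n))) \<longlonglongrightarrow> 0"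
    moreover have "\<exists>B::real. \<forall>n. qnorm \<rho>X (f n) \<le> ennreal B"
      using le by (intro exI[of _ 1]) simp
    ultimately show "(\<lambda>n. qnorm \<rho>Y (f n)) \<longlonglongrightarrow> 0" using seq by blast
  qed
qed

end
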